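(* Let $N\ge 1$ and $n\geq0$. The set $\{\widetilde{m}_{\lambda}:\lambda\in\mathcal{P}_{n}^{(N)}\}$ is a basis for the space of symmetric polynomials that are homogeneous of degree $n$ in the $N$ variables $x_1,\dots,x_N$. The transition matrix $B(\mu,\lambda)$ (with $\mu,\lambda\in\mathcal{P}_n^{(N)}$), defined by $m_{\lambda}=\sum_{\mu\in\mathcal{P}_n^{(N)}}B(\mu,\lambda)\,\widetilde{m}_{\mu}$, is triangular for the ordering $\preceq$ (that is, $B(\mu,\lambda)\neq0$ implies $\mu\preceq\lambda$) and is unipotent (that is, $B(\lambda,\lambda)=1$ for all $\lambda$) with integer entries.
   Context: $\mathbb{N}_0=\{0,1,2,\ldots\}$. A partition is a finite sequence $\lambda=(\lambda_1,\lambda_2,\ldots)$ of nonnegative integers with $\lambda_1\ge\lambda_2\ge\cdots\ge0$; partitions with the same nonzero components are identified (so $\lambda_i=0$ for $i$ beyond the length). $|\lambda|=\sum_i\lambda_i$ and $l(\lambda)=\#\{i:\lambda_i\ge1\}$. $\mathcal{P}_n^{(N)}$ is the set of partitions $\lambda$ with $|\lambda|=n$ and $l(\lambda)\le N$, regarded as elements of $\mathbb{N}_0^N$. For $\alpha\in\mathbb{N}_0^N$, $x^\alpha=\prod_{i=1}^N x_i^{\alpha_i}$ and $\alpha^+$ is the partition obtained by sorting the components of $\alpha$ in nonincreasing order. The monomial symmetric function is $m_\lambda=\sum\{x^\alpha:\alpha\in\mathbb{N}_0^N,\alpha^+=\lambda\}$ and $e_1=\sum_{i=1}^N x_i$. The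 modified monomial symmetric function is $\widetilde m_\lambda=e_1^{\lambda_1-\lambda_2}\,m_{(\lambda_2,\lambda_2,\lambda_3,\ldots)}$. For partitions $\lambda,\mu$, the relation $\mu\preceq\lambda$ means $|\lambda|=|\mu|$ and $\lambda_i\le\mu_i$ for all $i\ge2$. This is a partial order. *)

theory Defs
  imports Complex_Main "HOL-Library.Poly_Mapping" "HOL-Combinatorics.Permutations"
begin

text \<open>
  Exponent vectors and partitions are finitely supported maps \<open>nat \<Rightarrow>\<^sub>0 nat\<close>; indices are
  shifted by one throughout, so \<open>Poly_Mapping.lookup lam i\<close> is $\lambda_{i+1}$ and
  \<open>X i\<close> is $x_{i+1}$. Partitions differing only in trailing zeros are thus identified.
  Polynomials are finitely supported maps from exponent vectors to coefficients, with the
  convolution product of \<open>Poly_Mapping\<close>.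
\<close>

type_synonym 'a mpoly = "(nat \<Rightarrow>\<^sub>0 nat) \<Rightarrow>\<^sub>0 'a"

definition X :: "nat \<Rightarrow> 'a::comm_ring_1 mpoly" where
  "X i = Poly_Mapping.single (Poly_Mapping.single i 1) 1"

definition scale :: "'a::comm_ring_1 \<Rightarrow> 'a mpoly \<Rightarrow> 'a mpoly" where
  "scale c p = Poly_Mapping.single 0 c * p"

global_interpretation mpoly: vector_space "scale :: 'a::field \<Rightarrow> 'a mpoly \<Rightarrow> 'a mpoly"
  by standard
    (simp_all add: scale_def distrib_left distrib_right single_add mult_single
      flip: mult.assoc)

definition exponents :: "nat \<Rightarrow> (nat \<Rightarrow>\<^sub>0 nat) set" where
  "exponents N = {\<alpha>. Poly_Mapping.keys \<alpha> \<subseteq> {..<N}}"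

definition weight :: "(nat \<Rightarrow>\<^sub>0 nat) \<Rightarrow> nat" where
  "weight \<alpha> = (\<Sum>i\<in>Poly_Mapping.keys \<alpha>. Poly_Mapping.lookup \<alpha> i)"

definition partition :: "(nat \<Rightarrow>\<^sub>0 nat) \<Rightarrow> bool" where
  "partition lam \<longleftrightarrow> antimono (Poly_Mapping.lookup lam)"

definition partitions :: "nat \<Rightarrow> nat \<Rightarrow> (nat \<Rightarrow>\<^sub>0 nat) set" where
  "partitions N n =
    {lam. partition lam \<and> weight lam = n \<and> card {i. Poly_Mapping.lookup lam i \<ge> 1} \<le> N}"

definition sort_exponent :: "nat \<Rightarrow> (nat \<Rightarrow>\<^sub>0 nat) \<Rightarrow> (nat \<Rightarrow>\<^sub>0 nat)" where
  "sort_exponent N \<alpha> = Poly_Mapping.nth (rev (sort (map (Poly_Mapping.lookup \<alpha>) [0..<N])))"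

definition monomial :: "nat \<Rightarrow> (nat \<Rightarrow>\<^sub>0 nat) \<Rightarrow> 'a::comm_ring_1 mpoly" where
  "monomial N \<alpha> = (\<Prod>i<N. X i ^ Poly_Mapping.lookup \<alpha> i)"

definition msym :: "nat \<Rightarrow> (nat \<Rightarrow>\<^sub>0 nat) \<Rightarrow> 'a::comm_ring_1 mpoly" where
  "msym N lam = (\<Sum>\<alpha> | \<alpha> \<in> exponents N \<and> sort_exponent N \<alpha> = lam. monomial N \<alpha>)"

definition e1 :: "nat \<Rightarrow> 'a::comm_ring_1 mpoly" where
  "e1 N = (\<Sum>i<N. X i)"

text \<open>The update below replaces $(\lambda_1,\lambda_2,\lambda_3,\ldots)$ by
  $(\lambda_2,\lambda_2,\lambda_3,\ldots)$.\<close>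

definition msym_mod :: "nat \<Rightarrow> (nat \<Rightarrow>\<^sub>0 nat) \<Rightarrow> 'a::comm_ring_1 mpoly" where
  "msym_mod N lam =
    e1 N ^ (Poly_Mapping.lookup lam 0 - Poly_Mapping.lookup lam 1) *
    msym N (Poly_Mapping.update 0 (Poly_Mapping.lookup lam 1) lam)"

definition preceq :: "(nat \<Rightarrow>\<^sub>0 nat) \<Rightarrow> (nat \<Rightarrow>\<^sub>0 nat) \<Rightarrow> bool" (infix \<open>\<preceq>\<close> 50) where
  "\<mu> \<preceq> lam \<longleftrightarrow>
    weight lam = weight \<mu> \<and> (\<forall>i\<ge>1. Poly_Mapping.lookup lam i \<le> Poly_Mapping.lookup \<mu> i)"

definition permute_vars :: "(nat \<Rightarrow> nat) \<Rightarrow> 'a::comm_ring_1 mpoly \<Rightarrow> 'a mpoly" where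
  "permute_vars \<sigma> p =
    (\<Sum>\<alpha>\<in>Poly_Mapping.keys p. scale (Poly_Mapping.lookup p \<alpha>)
      (\<Prod>i\<in>Poly_Mapping.keys \<alpha>. X (\<sigma> i) ^ Poly_Mapping.lookup \<alpha> i))"

definition sym_homogeneous :: "nat \<Rightarrow> nat \<Rightarrow> 'a::comm_ring_1 mpoly set" where
  "sym_homogeneous N n =
    {p. (\<forall>\<alpha>\<in>Poly_Mapping.keys p. \<alpha> \<in> exponents N \<and> weight \<alpha> = n) \<and>
        (\<forall>\<sigma>. \<sigma> permutes {..<N} \<longrightarrow> permute_vars \<sigma> p = p)}"

definition transition_matrix ::
  "nat \<Rightarrow> nat \<Rightarrow> ((nat \<Rightarrow>\<^sub>0 nat) \<Rightarrow> (nat \<Rightarrow>\<^sub>0 nat) \<Rightarrow> 'a::comm_ring_1) \<Rightarrow> bool" where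
  "transition_matrix N n B \<longleftrightarrow>
    (\<forall>lam\<in>partitions N n. msym N lam = (\<Sum>\<mu>\<in>partitions N n. scale (B \<mu> lam) (msym_mod N \<mu>)))"

text \<open>The index sets of the sums above are finite.\<close>

lemma lookup_exponents: "\<alpha> \<in> exponents N \<Longrightarrow> N \<le> k \<Longrightarrow> Poly_Mapping.lookup \<alpha> k = 0"
  using in_keys_iff[of k \<alpha>] unfolding exponents_def by fastforce

lemma lookup_le_weight: "Poly_Mapping.lookup \<alpha> i \<le> weight \<alpha>"
proof (cases "i \<in> Poly_Mapping.keys \<alpha>")
  case True
  then show ?thesis unfolding weight_def by (intro member_le_sum) simp_all
next
  case False
  then show ?thesis by (simp add: in_keys_iff)
qed

lemma finite_exponents_weight: "finite {\<alpha> \<in> exponents N. weight \<alpha> = n}" (is "finite ?S")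
proof -
  let ?f = "\<lambda>\<alpha>::nat \<Rightarrow>\<^sub>0 nat. map (Poly_Mapping.lookup \<alpha>) [0..<N]"
  have "inj_on ?f ?S"
  proof (rule inj_onI)
    fix \<alpha> \<beta>
    assume "\<alpha> \<in> ?S" "\<beta> \<in> ?S" "?f \<alpha> = ?f \<beta>"
    then have ab: "\<alpha> \<in> exponents N" "\<beta> \<in> exponents N"
      and eq: "\<forall>k<N. Poly_Mapping.lookup \<alpha> k = Poly_Mapping.lookup \<beta> k"
      by simp_all
    show "\<alpha> = \<beta>"
    proof (rule poly_mapping_eqI)
      fix k
      show "Poly_Mapping.lookup \<alpha> k = Poly_Mapping.lookup \<beta> k"
        using ab eq by (cases "k < N") (simp_all add: lookup_exponents)
    qed
  qed
  moreover have "?f ` ?S \<subseteq> {xs. set xs \<subseteq> {..n} \<and> length xs = N}"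
    using lookup_le_weight by auto
  then have "finite (?f ` ?S)"
    by (rule finite_subset) (simp add: finite_lists_length_eq)
  ultimately show ?thesis
    using finite_imageD by blast
qed

lemma partitions_subset_exponents: "partitions N n \<subseteq> {\<alpha> \<in> exponents N. weight \<alpha> = n}"
proof
  fix lam assume l: "lam \<in> partitions N n"
  have "i < N" if i: "i \<in> Poly_Mapping.keys lam" for i
  proof -
    have "{..i} \<subseteq> {j. Poly_Mapping.lookup lam j \<ge> 1}"
    proof
      fix j assume "j \<in> {..i}"
      then have "Poly_Mapping.lookup lam i \<le> Poly_Mapping.lookup lam j"
        using l by (auto simp: partitions_def partition_def dest: antimonoD)
      then show "j \<in> {j. Poly_Mapping.lookup lam j \<ge> 1}"
        using i by (simp add: in_keys_iff)
    qed
    moreover have "{j. Poly_Mapping.lookup lam j \<ge> 1} = Poly_Mapping.keys lam"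
      by (auto simp: in_keys_iff)
    ultimately have "card {..i} \<le> card {j. Poly_Mapping.lookup lam j \<ge> 1}"
      by (metis card_mono finite_keys)
    also have "\<dots> \<le> N" using l by (simp add: partitions_def)
    finally show ?thesis by simp
  qed
  then show "lam \<in> {\<alpha> \<in> exponents N. weight \<alpha> = n}"
    using l by (auto simp: partitions_def exponents_def)
qed

lemma finite_partitions: "finite (partitions N n)"
  using partitions_subset_exponents finite_exponents_weight by (rule finite_subset)

lemma weight_exponent: "\<alpha> \<in> exponents N \<Longrightarrow> weight \<alpha> = (\<Sum>i<N. Poly_Mapping.lookup \<alpha> i)"
  unfolding weight_def exponents_def
  by (rule sum.mono_neutral_left) (auto simp: in_keys_iff)

lemma weight_sort_exponent:
  assumes "\<alpha> \<in> exponents N"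
  shows "weight (sort_exponent N \<alpha>) = weight \<alpha>"
proof -
  let ?xs = "rev (sort (map (Poly_Mapping.lookup \<alpha>) [0..<N]))"
  have "sort_exponent N \<alpha> \<in> exponents N"
    by (auto simp: exponents_def sort_exponent_def in_set_enumerate_eq)
  then have "weight (sort_exponent N \<alpha>) = (\<Sum>i<N. nth_default 0 ?xs i)"
    by (simp add: weight_exponent sort_exponent_def)
  also have "\<dots> = sum_list ?xs"
    by (simp add: sum_list_sum_nth nth_default_def atLeast0LessThan)
  also have "\<dots> = sum_mset (mset ?xs)"
    by (rule sum_mset_sum_list[symmetric])
  also have "\<dots> = sum_mset (mset (map (Poly_Mapping.lookup \<alpha>) [0..<N]))"
    by simp
  also have "\<dots> = sum_list (map (Poly_Mapping.lookup \<alpha>) [0..<N])"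
    by (rule sum_mset_sum_list)
  also have "\<dots> = weight \<alpha>"
    using assms by (simp add: weight_exponent sum_list_sum_nth atLeast0LessThan)
  finally show ?thesis .
qed

lemma finite_msym_index: "finite {\<alpha>. \<alpha> \<in> exponents N \<and> sort_exponent N \<alpha> = lam}"
  by (rule finite_subset[OF _ finite_exponents_weight[of N "weight lam"]])
    (auto simp: weight_sort_exponent)

end

theory Submission
  imports Defs
begin

text \<open>
  Write \<open>\<nu>\<close> for \<open>lam\<close> with its first part lowered to its second. A monomial of
  \<open>e1 ^ k * msym \<nu>\<close> dominates some rearrangement of \<open>\<nu>\<close> componentwise, so if its exponent \<open>\<mu>\<close> is
  a partition then \<open>\<mu> \<preceq> lam\<close>. If moreover \<open>\<mu> = lam\<close>, comparing weights shows that the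
  rearrangement is \<open>\<nu>\<close> itself, so the coefficient is \<open>1\<close>. Hence the \<open>msym_mod\<close> expand
  unitriangularly, with integer coefficients, in the \<open>msym\<close>, and such a matrix can be inverted
  over the integers along \<open>\<preceq>\<close>.
\<close>

abbreviation (input) lookup where "lookup \<equiv> Poly_Mapping.lookup"
abbreviation (input) single where "single \<equiv> Poly_Mapping.single"
abbreviation (input) keys where "keys \<equiv> Poly_Mapping.keys"

subsection \<open>Coefficients\<close>

lemma lookup_scale: "lookup (scale c p) \<gamma> = c * lookup p \<gamma>"
  unfolding scale_def lookup_mult lookup_single
  by (simp add: when_mult)

lemma lookup_map_key: "inj f \<Longrightarrow> lookup (Poly_Mapping.map_key f p) k = lookup p (f k)"
  by (simp add: map_key.rep_eq)

lemma X_power: "X i ^ k = single (single i k) 1"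
  by (induction k) (simp_all add: X_def mult_single single_add[symmetric] add.commute)

lemma prod_X_power:
  "finite I \<Longrightarrow> (\<Prod>i\<in>I. X (f i) ^ g i) = single (\<Sum>i\<in>I. single (f i) (g i)) 1"
  by (induction I rule: finite_induct) (simp_all add: X_power mult_single)

lemma lookup_sum_single:
  assumes "finite I" "inj_on f I" "i \<in> I"
  shows "lookup (\<Sum>i\<in>I. single (f i) (g i)) (f i) = g i"
proof -
  have "lookup (\<Sum>i\<in>I. single (f i) (g i)) (f i) = (\<Sum>j\<in>I. g j when f j = f i)"
    by (simp add: lookup_sum lookup_single)
  also have "\<dots> = (\<Sum>j\<in>I. if j = i then g j else 0)"
    using assms by (intro sum.cong) (auto simp: when_def dest: inj_onD)
  finally show ?thesis using assms by simp
qed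

lemma lookup_sum_single_notin:
  "k \<notin> f ` I \<Longrightarrow> lookup (\<Sum>i\<in>I. single (f i) (g i)) k = 0"
  by (auto simp: lookup_sum lookup_single when_def intro!: sum.neutral)

text \<open>The sum is the exponent of the image of \<open>x^\<alpha>\<close> under
  \<open>x_i -> x_(\<sigma> i)\<close>. Injectivity lets each position \<open>\<sigma> i\<close>
  receive \<open>lookup \<alpha> i\<close> and nothing else; outside \<open>range \<sigma>\<close>
  both exponents vanish.\<close>

lemma sum_single_eq_iff:
  assumes "finite I" "inj \<sigma>" "keys \<alpha> \<subseteq> I" "keys \<beta> \<subseteq> range \<sigma>"
  shows "(\<Sum>i\<in>I. single (\<sigma> i) (lookup \<alpha> i)) = \<beta> \<longleftrightarrow> \<alpha> = Poly_Mapping.map_key \<sigma> \<beta>"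
    (is "?s = \<beta> \<longleftrightarrow> _")
proof -
  have s: "lookup ?s (\<sigma> i) = lookup \<alpha> i" for i
  proof (cases "i \<in> I")
    case True
    then show ?thesis
      using lookup_sum_single[of I \<sigma> i "lookup \<alpha>"] assms inj_on_subset[of \<sigma> UNIV] by blast
  next
    case False
    moreover have "\<sigma> i \<notin> \<sigma> ` I" using False assms(2) by (simp add: inj_image_mem_iff)
    moreover have "lookup \<alpha> i = 0" using False assms(3) by (auto simp: in_keys_iff)
    ultimately show ?thesis by (simp add: lookup_sum_single_notin)
  qed
  have s': "lookup ?s k = lookup \<beta> k" if "k \<notin> range \<sigma>" for k
  proof -
    have "k \<notin> \<sigma> ` I" using that by auto
    moreover have "lookup \<beta> k = 0" using that assms(4) by (auto simp: in_keys_iff)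
    ultimately show ?thesis by (simp add: lookup_sum_single_notin)
  qed
  have "?s = \<beta> \<longleftrightarrow> (\<forall>i. lookup ?s (\<sigma> i) = lookup \<beta> (\<sigma> i))"
  proof
    assume *: "\<forall>i. lookup ?s (\<sigma> i) = lookup \<beta> (\<sigma> i)"
    show "?s = \<beta>"
    proof (rule poly_mapping_eqI)
      show "lookup ?s k = lookup \<beta> k" for k
        using * s'[of k] by (cases "k \<in> range \<sigma>") auto
    qed
  qed simp
  also have "\<dots> \<longleftrightarrow> \<alpha> = Poly_Mapping.map_key \<sigma> \<beta>"
    unfolding s poly_mapping_eq_iff fun_eq_iff using assms(2) by (simp add: lookup_map_key)
  finally show ?thesis .
qed

lemma monomial_eq_single:
  assumes "\<alpha> \<in> exponents N"
  shows "monomial N \<alpha> = single \<alpha> 1"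
proof -
  have "keys \<alpha> \<subseteq> {..<N}" using assms by (simp add: exponents_def)
  then have "(\<Sum>i<N. single i (lookup \<alpha> i)) = \<alpha>"
    using sum_single_eq_iff[of "{..<N}" "\<lambda>i. i" \<alpha> \<alpha>] by (simp add: map_key_id)
  then show ?thesis by (simp add: monomial_def prod_X_power)
qed

text \<open>Only one monomial of \<open>p\<close> is carried to \<open>x^\<beta>\<close>, and
  surjectivity of \<open>\<sigma>\<close> ensures that \<open>\<beta>\<close> is supported on its
  range. Symmetry thereby becomes invariance of the coefficients under
  \<open>map_key\<close>.\<close>

lemma lookup_permute_vars:
  assumes "bij \<sigma>"
  shows "lookup (permute_vars \<sigma> p) \<beta> = lookup p (Poly_Mapping.map_key \<sigma> \<beta>)"
proof -
  have "(\<Sum>i\<in>keys \<alpha>. single (\<sigma> i) (lookup \<alpha> i)) = \<beta> \<longleftrightarrow> \<alpha> = Poly_Mapping.map_key \<sigma> \<beta>" for \<alpha>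
    using assms by (intro sum_single_eq_iff) (auto simp: bij_def)
  then have "lookup (permute_vars \<sigma> p) \<beta> =
      (\<Sum>\<alpha>\<in>keys p. if \<alpha> = Poly_Mapping.map_key \<sigma> \<beta> then lookup p \<alpha> else 0)"
    by (simp add: permute_vars_def lookup_sum lookup_scale prod_X_power lookup_single when_def
        if_distrib cong: if_cong)
  then show ?thesis by (simp add: in_keys_iff)
qed

section \<open>Coefficients of products with \<open>e1\<close> and of \<open>msym\<close>\<close>

lemma lookup_X_mult:
  "lookup (X i * p) \<gamma> = (if lookup \<gamma> i \<ge> 1 then lookup p (\<gamma> - single i 1) else 0)"
proof -
  \<comment> \<open>Subtraction of exponents is truncated, so the condition
    \<open>lookup \<gamma> i \<ge> 1\<close> is what makes \<open>\<gamma> - single i 1\<close> a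
    true quotient.\<close>
  have *: "\<gamma> = single i 1 + q \<longleftrightarrow> lookup \<gamma> i \<ge> 1 \<and> q = \<gamma> - single i 1" for q
    by (auto simp: poly_mapping_eq_iff fun_eq_iff lookup_add lookup_minus lookup_single when_def)
  have "lookup (X i * p) \<gamma> = (\<Sum>q. lookup p q when \<gamma> = single i 1 + q)"
    unfolding lookup_mult X_def lookup_single by (simp add: when_mult)
  also have "\<dots> = (if lookup \<gamma> i \<ge> 1 then lookup p (\<gamma> - single i 1) else 0)"
    unfolding * by (auto simp: when_def)
  finally show ?thesis .
qed

text \<open>This recursion replaces a multinomial expansion: support, integrality and the diagonal
  coefficient of \<open>e1 N ^ k * msym N \<nu>\<close> are all obtained from it by induction on
  \<open>k\<close>.\<close>

lemma lookup_e1_mult: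
  "lookup (e1 N * p) \<gamma> =
    (\<Sum>i<N. if lookup \<gamma> i \<ge> 1 then lookup p (\<gamma> - single i 1) else 0)"
  by (simp add: e1_def sum_distrib_right lookup_sum lookup_X_mult)

lemma lookup_e1_mult_nonzeroE:
  assumes "lookup (e1 N * p) \<gamma> \<noteq> 0"
  obtains i where "i < N" "lookup \<gamma> i \<ge> 1" "lookup p (\<gamma> - single i 1) \<noteq> 0"
  using assms unfolding lookup_e1_mult
  by (auto elim!: sum.not_neutral_contains_not_neutral split: if_splits)

lemma lookup_msym:
  "lookup (msym N lam) \<gamma> = (if \<gamma> \<in> exponents N \<and> sort_exponent N \<gamma> = lam then 1 else 0)"
proof -
  have "lookup (msym N lam) \<gamma> =
      (\<Sum>\<alpha> | \<alpha> \<in> exponents N \<and> sort_exponent N \<alpha> = lam. if \<alpha> = \<gamma> then 1 else 0)"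
    unfolding msym_def lookup_sum
    by (intro sum.cong) (auto simp: monomial_eq_single lookup_single when_def)
  then show ?thesis
    using finite_msym_index[of N lam] by simp
qed

subsection \<open>Sorting exponents\<close>

lemma sort_exponent_in_exponents: "sort_exponent N \<alpha> \<in> exponents N"
  by (auto simp: exponents_def sort_exponent_def in_set_enumerate_eq)

lemma partition_sort_exponent: "partition (sort_exponent N \<alpha>)"
  unfolding partition_def
proof (rule antimonoI)
  fix i j :: nat assume "i \<le> j"
  moreover have "sorted_wrt (\<ge>) (rev (sort (map (lookup \<alpha>) [0..<N])))"
    by (simp add: sorted_wrt_rev)
  ultimately show "lookup (sort_exponent N \<alpha>) j \<le> lookup (sort_exponent N \<alpha>) i"
    by (cases "i = j")
      (auto simp: sort_exponent_def nth_default_def sorted_wrt_iff_nth_less)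
qed

text \<open>Turns sorting of lists into the action of a permutation of the variables. Together with
  \<open>sort_exponent_map_key\<close> it identifies the fibres of \<open>sort_exponent N\<close> on
  \<open>exponents N\<close> with the orbits of that action.\<close>

lemma sort_exponent_permutes:
  assumes "\<alpha> \<in> exponents N"
  obtains \<sigma> where "\<sigma> permutes {..<N}"
    "Poly_Mapping.map_key \<sigma> \<alpha> = sort_exponent N \<alpha>"
proof -
  let ?xs = "map (lookup \<alpha>) [0..<N]"
  obtain \<sigma> where "\<sigma> permutes {..<length ?xs}" and eq: "permute_list \<sigma> ?xs = rev (sort ?xs)"
    by (rule mset_eq_permutation[of "rev (sort ?xs)" ?xs]) auto
  then have \<sigma>: "\<sigma> permutes {..<N}" by simp
  have "lookup (Poly_Mapping.map_key \<sigma> \<alpha>) i = lookup (sort_exponent N \<alpha>) i" for i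
  proof (cases "i < N")
    case True
    moreover have "\<sigma> i < N" using True permutes_in_image[OF \<sigma>, of i] by simp
    ultimately show ?thesis
      using \<sigma> by (simp add: lookup_map_key permutes_inj sort_exponent_def nth_default_def
          permute_list_nth flip: eq)
  next
    case False
    then have "\<sigma> i = i" using \<sigma> by (simp add: permutes_not_in)
    with False show ?thesis
      using \<sigma> assms sort_exponent_in_exponents[of N \<alpha>]
      by (simp add: lookup_map_key permutes_inj lookup_exponents)
  qed
  then show thesis using that \<sigma> by (blast intro: poly_mapping_eqI)
qed

lemma map_key_in_exponents:
  assumes "\<sigma> permutes {..<N}"
  shows "Poly_Mapping.map_key \<sigma> \<alpha> \<in> exponents N \<longleftrightarrow> \<alpha> \<in> exponents N"
proof -
  have "\<sigma> -` keys \<alpha> \<subseteq> {..<N} \<longleftrightarrow> keys \<alpha> \<subseteq> {..<N}"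
    using permutes_vimage[OF assms] permutes_surj[OF assms]
    by (metis surj_image_vimage_eq image_mono vimage_mono)
  then show ?thesis
    using assms by (simp add: exponents_def keys_map_key permutes_inj)
qed

lemma sort_exponent_map_key:
  assumes \<sigma>: "\<sigma> permutes {..<N}"
  shows "sort_exponent N (Poly_Mapping.map_key \<sigma> \<alpha>) = sort_exponent N \<alpha>"
proof -
  let ?xs = "map (lookup \<alpha>) [0..<N]"
  have "map (lookup (Poly_Mapping.map_key \<sigma> \<alpha>)) [0..<N] = permute_list \<sigma> ?xs"
  proof (rule nth_equalityI)
    fix i assume "i < length (map (lookup (Poly_Mapping.map_key \<sigma> \<alpha>)) [0..<N])"
    moreover from this have "\<sigma> i < N" using permutes_in_image[OF \<sigma>, of i] by simp
    ultimately show "map (lookup (Poly_Mapping.map_key \<sigma> \<alpha>)) [0..<N] ! i = permute_list \<sigma> ?xs ! i"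
      using \<sigma> by (simp add: permute_list_nth lookup_map_key permutes_inj)
  qed simp
  moreover have "mset (permute_list \<sigma> ?xs) = mset ?xs"
    using \<sigma> by (intro mset_permute_list) simp
  then have "sort (permute_list \<sigma> ?xs) = sort ?xs"
    by (metis properties_for_sort mset_sort sorted_sort)
  ultimately show ?thesis by (simp add: sort_exponent_def)
qed

lemma sort_exponent_partition:
  assumes "partition \<alpha>" "\<alpha> \<in> exponents N"
  shows "sort_exponent N \<alpha> = \<alpha>"
proof -
  let ?xs = "map (lookup \<alpha>) [0..<N]"
  have "sorted (rev ?xs)"
    unfolding sorted_wrt_rev unfolding sorted_wrt_iff_nth_less
  proof (intro allI impI)
    fix i j assume "i < j" "j < length ?xs"
    then show "?xs ! i \<ge> ?xs ! j"
      using antimonoD[of "lookup \<alpha>" i j] assms(1) by (simp add: partition_def)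
  qed
  then have "rev (sort ?xs) = ?xs"
    by (metis mset_rev properties_for_sort rev_rev_ident)
  then show ?thesis
    using assms(2)
    by (intro poly_mapping_eqI) (simp add: sort_exponent_def nth_default_def lookup_exponents)
qed

text \<open>Among the first \<open>i + 1\<close> parts of the sorted exponent, one comes from an index \<open>j \<ge> i\<close>.\<close>

lemma sort_exponent_le_partition:
  assumes "\<alpha> \<in> exponents N" "partition \<mu>" "\<And>j. lookup \<alpha> j \<le> lookup \<mu> j"
  shows "lookup (sort_exponent N \<alpha>) i \<le> lookup \<mu> i"
proof -
  obtain \<sigma> where \<sigma>: "\<sigma> permutes {..<N}" "Poly_Mapping.map_key \<sigma> \<alpha> = sort_exponent N \<alpha>"
    using sort_exponent_permutes[OF assms(1)] .
  have inj: "inj \<sigma>" using \<sigma>(1) by (rule permutes_inj)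
  have "\<not> \<sigma> ` {..i} \<subseteq> {..<i}"
  proof
    assume "\<sigma> ` {..i} \<subseteq> {..<i}"
    then have "card (\<sigma> ` {..i}) \<le> card {..<i}" by (intro card_mono) auto
    then show False using inj_on_subset[OF inj] by (simp add: card_image)
  qed
  then obtain k where k: "k \<le> i" "i \<le> \<sigma> k" by fastforce
  have "lookup (sort_exponent N \<alpha>) i \<le> lookup (sort_exponent N \<alpha>) k"
    using partition_sort_exponent k(1) unfolding partition_def by (rule antimonoD)
  also have "\<dots> = lookup \<alpha> (\<sigma> k)" using inj by (simp flip: \<sigma>(2) add: lookup_map_key)
  also have "\<dots> \<le> lookup \<mu> (\<sigma> k)" by (rule assms)
  also have "\<dots> \<le> lookup \<mu> i" using assms(2) k(2) unfolding partition_def by (rule antimonoD)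
  finally show ?thesis .
qed

text \<open>The nonzero parts of a nonincreasing sequence fill an initial segment, so bounding their
  number by \<open>N\<close> amounts to bounding their positions.\<close>

lemma partitions_iff:
  "lam \<in> partitions N n \<longleftrightarrow> partition lam \<and> weight lam = n \<and> lam \<in> exponents N"
proof
  assume "lam \<in> partitions N n"
  then show "partition lam \<and> weight lam = n \<and> lam \<in> exponents N"
    using partitions_subset_exponents by (auto simp: partitions_def)
next
  assume *: "partition lam \<and> weight lam = n \<and> lam \<in> exponents N"
  have "{i. lookup lam i \<ge> 1} = keys lam" by (auto simp: in_keys_iff)
  moreover have "card (keys lam) \<le> N"
    using * card_mono[of "{..<N}" "keys lam"] by (simp add: exponents_def)
  ultimately show "lam \<in> partitions N n" using * by (simp add: partitions_def)
qed

lemma sort_exponent_in_partitions: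
  "\<alpha> \<in> exponents N \<Longrightarrow> sort_exponent N \<alpha> \<in> partitions N (weight \<alpha>)"
  by (simp add: partitions_iff partition_sort_exponent sort_exponent_in_exponents
      weight_sort_exponent)

subsection \<open>Symmetric polynomials\<close>

lemma sym_homogeneous_iff:
  "p \<in> sym_homogeneous N n \<longleftrightarrow>
    (\<forall>\<alpha>. lookup p \<alpha> \<noteq> 0 \<longrightarrow> \<alpha> \<in> exponents N \<and> weight \<alpha> = n) \<and>
    (\<forall>\<sigma> \<alpha>. \<sigma> permutes {..<N} \<longrightarrow> lookup p (Poly_Mapping.map_key \<sigma> \<alpha>) = lookup p \<alpha>)"
proof -
  have "permute_vars \<sigma> p = p \<longleftrightarrow> (\<forall>\<alpha>. lookup p (Poly_Mapping.map_key \<sigma> \<alpha>) = lookup p \<alpha>)"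
    if "\<sigma> permutes {..<N}" for \<sigma>
    using lookup_permute_vars[OF permutes_bij[OF that], of p] by (metis poly_mapping_eqI)
  then show ?thesis by (auto simp: sym_homogeneous_def in_keys_iff)
qed

lemma subspace_sym_homogeneous:
  "mpoly.subspace (sym_homogeneous N n :: 'a::field mpoly set)"
proof (rule mpoly.subspaceI)
  show "0 \<in> sym_homogeneous N n" by (simp add: sym_homogeneous_iff)
next
  fix p q :: "'a mpoly" assume p: "p \<in> sym_homogeneous N n" and q: "q \<in> sym_homogeneous N n"
  have "lookup p \<alpha> \<noteq> 0 \<or> lookup q \<alpha> \<noteq> 0" if "lookup (p + q) \<alpha> \<noteq> 0" for \<alpha>
    using that by (auto simp: lookup_add)
  then show "p + q \<in> sym_homogeneous N n"
    using p q unfolding sym_homogeneous_iff by (simp add: lookup_add) blast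
next
  fix c and p :: "'a mpoly" assume "p \<in> sym_homogeneous N n"
  then show "scale c p \<in> sym_homogeneous N n"
    unfolding sym_homogeneous_iff by (simp add: lookup_scale)
qed

lemma msym_in_sym_homogeneous:
  "msym N lam \<in> sym_homogeneous N (weight lam)"
  by (auto simp: sym_homogeneous_iff lookup_msym map_key_in_exponents sort_exponent_map_key
      weight_sort_exponent)

lemma e1_mult_in_sym_homogeneous:
  assumes p: "p \<in> sym_homogeneous N n"
  shows "e1 N * p \<in> sym_homogeneous N (Suc n)"
  unfolding sym_homogeneous_iff
proof (intro conjI allI impI)
  fix \<gamma> assume "lookup (e1 N * p) \<gamma> \<noteq> 0"
  then obtain i where i: "i < N" "lookup \<gamma> i \<ge> 1" "lookup p (\<gamma> - single i 1) \<noteq> 0"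
    by (rule lookup_e1_mult_nonzeroE)
  let ?\<delta> = "\<gamma> - single i 1"
  have \<delta>: "?\<delta> \<in> exponents N" "weight ?\<delta> = n"
    using p i(3) by (simp_all add: sym_homogeneous_iff)
  have \<gamma>: "lookup \<gamma> j = lookup ?\<delta> j + (if j = i then 1 else 0)" for j
    using i(2) by (simp add: lookup_minus lookup_single)
  have "keys \<gamma> \<subseteq> insert i (keys ?\<delta>)"
    by (auto simp: in_keys_iff lookup_minus lookup_single when_def split: if_splits)
  then show e: "\<gamma> \<in> exponents N" using \<delta>(1) i(1) by (auto simp: exponents_def)
  have "weight \<gamma> = (\<Sum>j<N. lookup ?\<delta> j + (if j = i then 1 else 0))"
    using e by (simp only: weight_exponent \<gamma>)
  also have "\<dots> = Suc n"
    using i(1) \<delta> by (simp add: sum.distrib weight_exponent)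
  finally show "weight \<gamma> = Suc n" .
next
  fix \<sigma> :: "nat \<Rightarrow> nat" and \<gamma> :: "nat \<Rightarrow>\<^sub>0 nat"
  assume \<sigma>: "\<sigma> permutes {..<N}"
  let ?P = "Poly_Mapping.map_key \<sigma> :: _ \<Rightarrow> nat \<Rightarrow>\<^sub>0 nat"
  have inj: "inj \<sigma>" using \<sigma> by (rule permutes_inj)
  \<comment> \<open>Lowering one part commutes with relabelling if the index \<open>i\<close> is
    moved to \<open>\<sigma> i\<close>; reindexing the sum by \<open>\<sigma>\<close> then absorbs
    this shift.\<close>
  have "?P \<gamma> - single i 1 = ?P (\<gamma> - single (\<sigma> i) 1)" for i
    using inj by (intro poly_mapping_eqI)
      (simp add: lookup_map_key lookup_minus lookup_single when_def inj_eq)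
  then have "lookup (e1 N * p) (?P \<gamma>) =
      (\<Sum>i<N. if lookup \<gamma> (\<sigma> i) \<ge> 1 then lookup p (\<gamma> - single (\<sigma> i) 1) else 0)"
    using p \<sigma> inj by (simp add: lookup_e1_mult lookup_map_key sym_homogeneous_iff cong: if_cong)
  also have "\<dots> = lookup (e1 N * p) \<gamma>"
    unfolding lookup_e1_mult
    using sum.permute[OF \<sigma>, of "\<lambda>i. if lookup \<gamma> i \<ge> 1 then lookup p (\<gamma> - single i 1) else 0"]
    by (simp add: comp_def)
  finally show "lookup (e1 N * p) (?P \<gamma>) = lookup (e1 N * p) \<gamma>" .
qed

lemma e1_power_mult_in_sym_homogeneous:
  "p \<in> sym_homogeneous N n \<Longrightarrow> e1 N ^ k * p \<in> sym_homogeneous N (n + k)"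
  by (induction k) (auto simp: mult.assoc intro: e1_mult_in_sym_homogeneous)

text \<open>The coefficients of \<open>p\<close> are constant on orbits of exponents, and each orbit
  contains exactly one partition, its sorted form. The coefficient of \<open>msym N lam\<close> can
  therefore be read off at \<open>lam\<close>.\<close>

lemma sym_homogeneous_expansion:
  fixes p :: "'a::comm_ring_1 mpoly"
  assumes p: "p \<in> sym_homogeneous N n"
  shows "p = (\<Sum>lam\<in>partitions N n. scale (lookup p lam) (msym N lam))"
proof (rule poly_mapping_eqI)
  fix \<gamma>
  have "lookup (\<Sum>lam\<in>partitions N n. scale (lookup p lam) (msym N lam)) \<gamma> =
      (\<Sum>lam\<in>partitions N n.
        if lam = sort_exponent N \<gamma> \<and> \<gamma> \<in> exponents N then lookup p lam else 0)"
    by (auto simp: lookup_sum lookup_scale lookup_msym intro!: sum.cong)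
  also have "\<dots> = (if \<gamma> \<in> exponents N \<and> sort_exponent N \<gamma> \<in> partitions N n
      then lookup p (sort_exponent N \<gamma>) else 0)"
    by (cases "\<gamma> \<in> exponents N") (simp_all add: finite_partitions)
  also have "\<dots> = lookup p \<gamma>"
  proof (cases "\<gamma> \<in> exponents N \<and> weight \<gamma> = n")
    case True
    then obtain \<sigma> where "\<sigma> permutes {..<N}" "Poly_Mapping.map_key \<sigma> \<gamma> = sort_exponent N \<gamma>"
      using sort_exponent_permutes by blast
    then have "lookup p (sort_exponent N \<gamma>) = lookup p \<gamma>"
      using p by (metis sym_homogeneous_iff)
    then show ?thesis using True sort_exponent_in_partitions by auto
  \<comment> \<open>The right-hand side vanishes here too, because sorting preserves the
    weight.\<close>
  next
    case False
    then have "lookup p \<gamma> = 0" using p unfolding sym_homogeneous_iff by blast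
    then show ?thesis using False by (auto simp: partitions_iff weight_sort_exponent)
  qed
  finally show "lookup p \<gamma> = lookup (\<Sum>lam\<in>partitions N n. scale (lookup p lam) (msym N lam)) \<gamma>"
    by simp
qed

subsection \<open>Triangularity\<close>

text \<open>Undoing a factor \<open>e1\<close> lowers one part by one; after \<open>k\<close> such
  steps the recursion ends at a monomial of \<open>msym N \<nu>\<close>, which lies below
  \<open>\<gamma>\<close>.\<close>

lemma lookup_e1_power_msym_nonzero:
  assumes "lookup (e1 N ^ k * msym N \<nu> :: 'a::comm_ring_1 mpoly) \<gamma> \<noteq> 0"
  shows "\<exists>\<alpha>\<in>exponents N. sort_exponent N \<alpha> = \<nu> \<and> (\<forall>j. lookup \<alpha> j \<le> lookup \<gamma> j)"
  using assms
proof (induction k arbitrary: \<gamma>)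
  case 0
  then show ?case by (auto simp: lookup_msym split: if_splits)
next
  case (Suc k)
  from Suc.prems obtain i where "lookup (e1 N ^ k * msym N \<nu> :: 'a mpoly) (\<gamma> - single i 1) \<noteq> 0"
    unfolding power_Suc mult.assoc by (rule lookup_e1_mult_nonzeroE)
  then obtain \<alpha> where "\<alpha> \<in> exponents N" "sort_exponent N \<alpha> = \<nu>"
    "\<forall>j. lookup \<alpha> j \<le> lookup (\<gamma> - single i 1) j"
    using Suc.IH by blast
  then show ?case
    by (metis diff_le_self le_trans lookup_minus)
qed

lemma lookup_e1_power_msym_Ints: "lookup (e1 N ^ k * msym N \<nu>) \<gamma> \<in> \<int>"
proof (induction k arbitrary: \<gamma>)
  case 0
  show ?case by (simp add: lookup_msym)
next
  case (Suc k)
  then show ?case by (auto simp: mult.assoc lookup_e1_mult intro!: Ints_sum)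
qed

lemma lookup_le_sort_exponent_0:
  assumes "\<alpha> \<in> exponents N"
  shows "lookup \<alpha> j \<le> lookup (sort_exponent N \<alpha>) 0"
proof -
  obtain \<sigma> where \<sigma>: "\<sigma> permutes {..<N}" "Poly_Mapping.map_key \<sigma> \<alpha> = sort_exponent N \<alpha>"
    using sort_exponent_permutes[OF assms] .
  obtain k where "j = \<sigma> k" using permutes_surj[OF \<sigma>(1)] by (metis surjD)
  then have "lookup \<alpha> j = lookup (sort_exponent N \<alpha>) k"
    using permutes_inj[OF \<sigma>(1)] by (simp flip: \<sigma>(2) add: lookup_map_key)
  then show ?thesis
    using partition_sort_exponent[of N \<alpha>] by (simp add: partition_def antimonoD)
qed

lemma weight_strict_mono:
  assumes "\<alpha> \<in> exponents N" "\<beta> \<in> exponents N"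
    and "\<And>j. lookup \<alpha> j \<le> lookup \<beta> j" "lookup \<alpha> i < lookup \<beta> i"
  shows "weight \<alpha> < weight \<beta>"
proof -
  have "i < N" using assms(2,4) lookup_exponents[of \<beta> N i] by (cases "i < N") auto
  then show ?thesis
    using assms by (auto simp: weight_exponent intro!: sum_strict_mono_ex1)
qed

text \<open>Away from index \<open>0\<close> the exponent \<open>\<gamma>\<close> is squeezed
  between \<open>\<alpha>\<close> and its sorted form, and at \<open>0\<close> the sorted form has
  the maximum of \<open>\<alpha>\<close>. So \<open>\<alpha>\<close> lies below its sorted form
  everywhere, and a gap at \<open>i\<close> would contradict the equality of their weights.\<close>

lemma sort_exponent_tail_le:
  assumes \<alpha>: "\<alpha> \<in> exponents N" "\<And>j. lookup \<alpha> j \<le> lookup \<gamma> j"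
    and le: "\<And>j. j \<noteq> 0 \<Longrightarrow> lookup \<gamma> j \<le> lookup (sort_exponent N \<alpha>) j"
    and i: "i \<noteq> 0"
  shows "lookup \<gamma> i = lookup (sort_exponent N \<alpha>) i"
proof (rule ccontr)
  assume "lookup \<gamma> i \<noteq> lookup (sort_exponent N \<alpha>) i"
  then have "lookup \<alpha> i < lookup (sort_exponent N \<alpha>) i"
    using le[OF i] \<alpha>(2)[of i] by simp
  moreover have "lookup \<alpha> j \<le> lookup (sort_exponent N \<alpha>) j" for j
    using lookup_le_sort_exponent_0[OF \<alpha>(1), of j] \<alpha>(2)[of j] le[of j]
    by (cases "j = 0") auto
  ultimately have "weight \<alpha> < weight (sort_exponent N \<alpha>)"
    using \<alpha>(1) sort_exponent_in_exponents by (intro weight_strict_mono)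
  then show False using \<alpha>(1) by (simp add: weight_sort_exponent)
qed

text \<open>By \<open>sort_exponent_tail_le\<close>, removing a unit from \<open>\<nu> + single 0 k\<close> at an index other than
  \<open>0\<close> leaves an exponent above no rearrangement of \<open>\<nu>\<close>, so one term of the recursion survives.\<close>

lemma lookup_e1_power_msym_self:
  assumes "N \<ge> 1" "partition \<nu>" "\<nu> \<in> exponents N"
  shows "lookup (e1 N ^ k * msym N \<nu>) (\<nu> + single 0 k) = (1 :: 'a::comm_ring_1)"
proof (induction k)
  case 0
  show ?case using assms by (simp add: lookup_msym sort_exponent_partition)
next
  case (Suc k)
  let ?p = "e1 N ^ k * msym N \<nu> :: 'a mpoly" and ?\<gamma> = "\<nu> + single 0 (Suc k)"
  have "(if lookup ?\<gamma> i \<ge> 1 then lookup ?p (?\<gamma> - single i 1) else 0) =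
      (if i = 0 then 1 else 0)" for i
  proof (cases "i = 0")
    case True
    have "?\<gamma> - single 0 1 = \<nu> + single 0 k"
      by (rule poly_mapping_eqI) (auto simp: lookup_add lookup_minus lookup_single when_def)
    with True Suc show ?thesis by (simp add: lookup_add)
  next
    case False
    have "lookup ?p (?\<gamma> - single i 1) = 0" if pos: "lookup ?\<gamma> i \<ge> 1"
    proof (rule ccontr)
      assume "lookup ?p (?\<gamma> - single i 1) \<noteq> 0"
      then obtain \<alpha> where \<alpha>: "\<alpha> \<in> exponents N" "sort_exponent N \<alpha> = \<nu>"
        "\<And>j. lookup \<alpha> j \<le> lookup (?\<gamma> - single i 1) j"
        using lookup_e1_power_msym_nonzero by blast
      have "lookup (?\<gamma> - single i 1) j \<le> lookup (sort_exponent N \<alpha>) j" if "j \<noteq> 0" for j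
        using that \<alpha>(2) by (simp add: lookup_minus lookup_add lookup_single)
      then have "lookup (?\<gamma> - single i 1) i = lookup (sort_exponent N \<alpha>) i"
        using \<alpha>(1,3) False by (intro sort_exponent_tail_le)
      \<comment> \<open>At \<open>i\<close> the lowered exponent is one less than the part of
        \<open>\<nu>\<close> it would have to equal.\<close>
      then show False
        using \<alpha>(2) False pos by (simp add: lookup_minus lookup_add lookup_single)
    qed
    with False show ?thesis by simp
  qed
  then have "lookup (e1 N * ?p) ?\<gamma> = (\<Sum>i<N. if i = 0 then 1 else 0)"
    unfolding lookup_e1_mult by (intro sum.cong) auto
  \<comment> \<open>\<open>N \<ge> 1\<close> puts the index \<open>0\<close> into the range of
    summation.\<close>
  also have "\<dots> = 1" using assms(1) by simp
  finally show ?case by (simp add: mult.assoc)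
qed

section \<open>Coefficients of the modified monomial symmetric functions\<close>

text \<open>Transfers the results on \<open>e1 N ^ k * msym N \<nu>\<close> to
  \<open>msym_mod N lam\<close>. Since \<open>lam\<close> is nonincreasing, the truncated difference
  of its first two parts is a true one, and adding it back restores \<open>lam\<close>.\<close>

lemma level_first_part:
  fixes lam :: "nat \<Rightarrow>\<^sub>0 nat"
  assumes "N \<ge> 1" and lam: "lam \<in> partitions N n"
  defines "\<nu> \<equiv> Poly_Mapping.update 0 (lookup lam 1) lam"
  shows "partition \<nu>" "\<nu> \<in> exponents N" "lam = \<nu> + single 0 (lookup lam 0 - lookup lam 1)"
    "weight \<nu> + (lookup lam 0 - lookup lam 1) = n"
proof -
  let ?k = "lookup lam 0 - lookup lam 1"
  have anti: "i \<le> j \<Longrightarrow> lookup lam j \<le> lookup lam i" for i j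
    using lam by (simp add: partitions_def partition_def antimonoD)
  have e: "lam \<in> exponents N" and w: "weight lam = n"
    using lam by (simp_all add: partitions_iff)
  have \<nu>: "lookup \<nu> i = (if i = 0 then lookup lam 1 else lookup lam i)" for i
    by (simp add: \<nu>_def lookup_update)
  show "partition \<nu>"
    unfolding partition_def by (rule antimonoI) (auto simp: \<nu> intro: anti)
  have "keys \<nu> \<subseteq> insert 0 (keys lam)"
    by (auto simp: in_keys_iff \<nu> split: if_splits)
  then show ex: "\<nu> \<in> exponents N" using e assms(1) by (auto simp: exponents_def)
  show eq: "lam = \<nu> + single 0 ?k"
    using anti[of 0 1]
    by (intro poly_mapping_eqI) (auto simp: lookup_add \<nu> lookup_single when_def)
  have "lookup lam i = lookup \<nu> i + (if i = 0 then ?k else 0)" for i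
    using anti[of 0 1] by (simp add: \<nu>)
  then have "weight lam = (\<Sum>i<N. lookup \<nu> i + (if i = 0 then ?k else 0))"
    unfolding weight_exponent[OF e] by (intro sum.cong) auto
  also have "\<dots> = weight \<nu> + ?k"
    using assms(1) ex by (simp add: sum.distrib weight_exponent)
  finally show "weight \<nu> + ?k = n" using w by simp
qed

lemma msym_mod_in_sym_homogeneous:
  assumes "N \<ge> 1" "lam \<in> partitions N n"
  shows "msym_mod N lam \<in> sym_homogeneous N n"
  unfolding msym_mod_def
  using e1_power_mult_in_sym_homogeneous[OF msym_in_sym_homogeneous]
  by (metis level_first_part(4)[OF assms])

lemma lookup_msym_mod_Ints: "lookup (msym_mod N lam) \<mu> \<in> \<int>"
  by (simp add: msym_mod_def lookup_e1_power_msym_Ints)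

lemma lookup_msym_mod_self:
  assumes "N \<ge> 1" "lam \<in> partitions N n"
  shows "lookup (msym_mod N lam) lam = 1"
  unfolding msym_mod_def
  using lookup_e1_power_msym_self[OF assms(1) level_first_part(1,2)[OF assms]]
  by (metis level_first_part(3)[OF assms])

text \<open>Some rearrangement of the levelled \<open>lam\<close> lies below \<open>\<mu>\<close>.
  As \<open>\<mu>\<close> is a partition, sorting keeps it below \<open>\<mu>\<close>, and from
  index \<open>1\<close> on the sorted exponent agrees with \<open>lam\<close>.\<close>

lemma lookup_msym_mod_nonzero:
  assumes "lam \<in> partitions N n" "\<mu> \<in> partitions N n" "lookup (msym_mod N lam) \<mu> \<noteq> 0"
  shows "\<mu> \<preceq> lam"
  unfolding preceq_def
proof (intro conjI allI impI)
  fix i :: nat assume "i \<ge> 1"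
  moreover obtain \<alpha> where \<alpha>: "\<alpha> \<in> exponents N"
    "sort_exponent N \<alpha> = Poly_Mapping.update 0 (lookup lam 1) lam"
    "\<And>j. lookup \<alpha> j \<le> lookup \<mu> j"
    using assms(3) lookup_e1_power_msym_nonzero unfolding msym_mod_def by blast
  have "partition \<mu>" using assms(2) by (simp add: partitions_iff)
  with \<alpha> have "lookup (sort_exponent N \<alpha>) i \<le> lookup \<mu> i"
    by (intro sort_exponent_le_partition)
  ultimately show "lookup lam i \<le> lookup \<mu> i"
    by (simp add: \<alpha>(2) lookup_update)
qed (use assms in \<open>simp add: partitions_iff\<close>)

section \<open>The order on partitions\<close>

lemma preceq_refl: "lam \<preceq> lam"
  by (simp add: preceq_def)

lemma preceq_trans: "\<kappa> \<preceq> \<mu> \<Longrightarrow> \<mu> \<preceq> lam \<Longrightarrow> \<kappa> \<preceq> lam"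
  unfolding preceq_def by (metis le_trans)

text \<open>Otherwise \<open>\<mu>\<close> would dominate \<open>lam\<close> in every part, and
  equal weights would force equality. The first part thus serves as a natural-number measure for the
  order.\<close>

lemma preceq_first_part_less:
  assumes "\<mu> \<preceq> lam" "\<mu> \<noteq> lam" "\<mu> \<in> partitions N n" "lam \<in> partitions N n"
  shows "lookup \<mu> 0 < lookup lam 0"
proof (rule ccontr)
  assume "\<not> lookup \<mu> 0 < lookup lam 0"
  then have le: "lookup lam i \<le> lookup \<mu> i" for i
    using assms(1) by (cases "i = 0") (auto simp: preceq_def)
  obtain i where "lookup lam i \<noteq> lookup \<mu> i"
    using assms(2) by (metis poly_mapping_eqI)
  then have "lookup lam i < lookup \<mu> i" using le[of i] by simp
  then have "weight lam < weight \<mu>"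
    using le assms(3,4) by (intro weight_strict_mono) (auto simp: partitions_iff)
  then show False using assms(3,4) by (simp add: partitions_iff)
qed

subsection \<open>Basis and transition matrix\<close>

text \<open>Among the partitions with nonzero coefficient, take \<open>\<mu>\<close> with the
  largest first part and compare coefficients at \<open>\<mu>\<close>. Any other
  \<open>\<kappa>\<close> contributing there satisfies \<open>\<mu> \<preceq> \<kappa>\<close>,
  hence has a larger first part and so \<open>c \<kappa> = 0\<close>. What remains is
  \<open>c \<mu>\<close>.\<close>

lemma msym_mod_coeffs_zero:
  fixes c :: "_ \<Rightarrow> 'a::field"
  assumes "N \<ge> 1" and sum0: "(\<Sum>lam\<in>partitions N n. scale (c lam) (msym_mod N lam)) = 0"
    and "lam \<in> partitions N n"
  shows "c lam = 0"
proof (rule ccontr)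
  assume "c lam \<noteq> 0"
  let ?S = "{\<mu> \<in> partitions N n. c \<mu> \<noteq> 0}"
  have "finite ?S" "?S \<noteq> {}" using finite_partitions assms(3) \<open>c lam \<noteq> 0\<close> by auto
  then obtain \<mu> where \<mu>: "\<mu> \<in> ?S" and max: "\<And>\<kappa>. \<kappa> \<in> ?S \<Longrightarrow> lookup \<kappa> 0 \<le> lookup \<mu> 0"
    using obtains_MAX[of ?S "\<lambda>\<kappa>. lookup \<kappa> 0"] by (metis (no_types, lifting) Max_ge finite_imageI imageI)
  have "c \<kappa> * lookup (msym_mod N \<kappa>) \<mu> = (if \<kappa> = \<mu> then c \<mu> else 0)"
    if \<kappa>: "\<kappa> \<in> partitions N n" for \<kappa>
  proof (cases "\<kappa> = \<mu>")
    case True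
    then show ?thesis using lookup_msym_mod_self[OF assms(1) \<kappa>, where 'a = 'a] by simp
  next
    case False
    then have "c \<kappa> = 0 \<or> \<not> \<mu> \<preceq> \<kappa>"
      using preceq_first_part_less[of \<mu> \<kappa> N n] \<mu> \<kappa> max[of \<kappa>] by fastforce
    then have "c \<kappa> = 0 \<or> lookup (msym_mod N \<kappa> :: 'a mpoly) \<mu> = 0"
      using lookup_msym_mod_nonzero \<kappa> \<mu> by blast
    with False show ?thesis by auto
  qed
  then have "lookup (\<Sum>\<kappa>\<in>partitions N n. scale (c \<kappa>) (msym_mod N \<kappa>)) \<mu> =
      (\<Sum>\<kappa>\<in>partitions N n. if \<kappa> = \<mu> then c \<mu> else 0)"
    unfolding lookup_sum lookup_scale by (intro sum.cong) auto
  then show False using sum0 \<mu> by (simp add: finite_partitions)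
qed

lemma msym_mod_coeffs_unique:
  fixes b c :: "_ \<Rightarrow> 'a::field"
  assumes "N \<ge> 1"
    and "(\<Sum>lam\<in>partitions N n. scale (b lam) (msym_mod N lam)) =
      (\<Sum>lam\<in>partitions N n. scale (c lam) (msym_mod N lam))"
    and "lam \<in> partitions N n"
  shows "b lam = c lam"
proof -
  have "(\<Sum>lam\<in>partitions N n. scale (b lam - c lam) (msym_mod N lam)) = 0"
    using assms(2) by (simp add: mpoly.scale_left_diff_distrib sum_subtractf)
  from msym_mod_coeffs_zero[OF assms(1) this assms(3)] show ?thesis by simp
qed

text \<open>If two modified functions coincided, two different indicator families would give the
  same linear combination.\<close>

lemma inj_on_msym_mod:
  assumes "N \<ge> 1"
  shows "inj_on (msym_mod N :: _ \<Rightarrow> 'a::field mpoly) (partitions N n)"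
proof (rule inj_onI)
  fix lam \<mu> assume *: "lam \<in> partitions N n" "\<mu> \<in> partitions N n"
    and eq: "(msym_mod N lam :: 'a mpoly) = msym_mod N \<mu>"
  have delta: "(\<Sum>\<kappa>\<in>partitions N n. scale (if \<kappa> = \<rho> then 1 else 0) (msym_mod N \<kappa>)) =
      (msym_mod N \<rho> :: 'a mpoly)" if "\<rho> \<in> partitions N n" for \<rho>
    using that
    by (simp add: if_distrib[of "\<lambda>c. scale c _"] finite_partitions cong: if_cong)
  have "(\<Sum>\<kappa>\<in>partitions N n. scale (if \<kappa> = lam then 1 else 0 :: 'a) (msym_mod N \<kappa>)) =
      (\<Sum>\<kappa>\<in>partitions N n. scale (if \<kappa> = \<mu> then 1 else 0) (msym_mod N \<kappa>))"
    using * by (simp only: delta eq)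
  from msym_mod_coeffs_unique[OF assms this *(1)] show "lam = \<mu>"
    by (simp split: if_splits)
qed

lemma independent_msym_mod:
  assumes "N \<ge> 1"
  shows "mpoly.independent ((msym_mod N :: _ \<Rightarrow> 'a::field mpoly) ` partitions N n)"
proof -
  have "u p = 0"
    if sum0: "(\<Sum>q\<in>(msym_mod N :: _ \<Rightarrow> 'a mpoly) ` partitions N n. scale (u q) q) = 0"
      and p: "p \<in> msym_mod N ` partitions N n" for u p
  proof -
    \<comment> \<open>Injectivity turns a relation over the image set into one indexed by
      partitions.\<close>
    have "(\<Sum>lam\<in>partitions N n. scale (u (msym_mod N lam)) (msym_mod N lam)) = 0"
      using sum0 unfolding sum.reindex[OF inj_on_msym_mod[OF assms]] comp_def .
    from msym_mod_coeffs_zero[OF assms this] show ?thesis using p by blast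
  qed
  then show ?thesis
    using finite_partitions by (intro mpoly.independent_if_scalars_zero) auto
qed

text \<open>The induction on the first part of \<open>lam\<close> works because \<open>\<mu> \<preceq> lam\<close> and \<open>\<mu> \<noteq> lam\<close> force
  \<open>\<mu>\<close> to have a smaller first part.\<close>

lemma msym_expansion:
  fixes lam :: "nat \<Rightarrow>\<^sub>0 nat"
  assumes N: "N \<ge> 1" and "lam \<in> partitions N n"
  shows "\<exists>b :: _ \<Rightarrow> 'a::field. (\<forall>\<mu>. b \<mu> \<in> \<int>) \<and> (\<forall>\<mu>\<in>partitions N n. b \<mu> \<noteq> 0 \<longrightarrow> \<mu> \<preceq> lam) \<and>
    b lam = 1 \<and> msym N lam = (\<Sum>\<mu>\<in>partitions N n. scale (b \<mu>) (msym_mod N \<mu>))"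
  using assms(2)
proof (induction "lookup lam 0" arbitrary: lam rule: less_induct)
  case less
  let ?P = "partitions N n"
  let ?m = "msym_mod N lam :: 'a mpoly"
  \<comment> \<open>The off-diagonal terms in the expansion of \<open>msym_mod N lam\<close>; by
    triangularity they all lie strictly below \<open>lam\<close>, so the induction hypothesis
    applies to them.\<close>
  define Q where "Q = {\<mu> \<in> ?P - {lam}. lookup ?m \<mu> \<noteq> 0}"
  have Q: "\<mu> \<in> ?P" "\<mu> \<preceq> lam" "lookup \<mu> 0 < lookup lam 0" if "\<mu> \<in> Q" for \<mu>
    using that lookup_msym_mod_nonzero[OF less.prems] preceq_first_part_less less.prems
    unfolding Q_def by blast+
  have "\<forall>\<mu>\<in>Q. \<exists>b :: _ \<Rightarrow> 'a. (\<forall>\<kappa>. b \<kappa> \<in> \<int>) \<and> (\<forall>\<kappa>\<in>?P. b \<kappa> \<noteq> 0 \<longrightarrow> \<kappa> \<preceq> \<mu>) \<and>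
    b \<mu> = 1 \<and> msym N \<mu> = (\<Sum>\<kappa>\<in>?P. scale (b \<kappa>) (msym_mod N \<kappa>))"
    using less.hyps Q by blast
  from bchoice[OF this] obtain b :: "_ \<Rightarrow> _ \<Rightarrow> 'a" where b: "\<And>\<mu> \<kappa>. \<mu> \<in> Q \<Longrightarrow> b \<mu> \<kappa> \<in> \<int>"
    "\<And>\<mu> \<kappa>. \<mu> \<in> Q \<Longrightarrow> \<kappa> \<in> ?P \<Longrightarrow> b \<mu> \<kappa> \<noteq> 0 \<Longrightarrow> \<kappa> \<preceq> \<mu>"
    "\<And>\<mu>. \<mu> \<in> Q \<Longrightarrow> msym N \<mu> = (\<Sum>\<kappa>\<in>?P. scale (b \<mu> \<kappa>) (msym_mod N \<kappa>))"
    by blast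
  \<comment> \<open>These coefficients come from solving that expansion for
    \<open>msym N lam\<close>, whose own coefficient is \<open>1\<close>, and inserting the
    expansions \<open>b \<mu>\<close> of the other terms.\<close>
  define c where "c \<kappa> = (if \<kappa> = lam then 1 else 0) - (\<Sum>\<mu>\<in>Q. lookup ?m \<mu> * b \<mu> \<kappa>)" for \<kappa>
  have c_nz: "\<kappa> = lam \<or> (\<exists>\<mu>\<in>Q. b \<mu> \<kappa> \<noteq> 0)" if "c \<kappa> \<noteq> 0" for \<kappa>
  proof (rule ccontr)
    assume "\<not> ?thesis"
    then have "c \<kappa> = 0" by (auto simp: c_def intro!: sum.neutral)
    with that show False ..
  qed
  have "c \<kappa> \<in> \<int>" for \<kappa>
    unfolding c_def using b(1) lookup_msym_mod_Ints by (auto intro!: Ints_diff Ints_sum Ints_mult)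
  moreover have "\<kappa> \<preceq> lam" if "\<kappa> \<in> ?P" "c \<kappa> \<noteq> 0" for \<kappa>
    using c_nz[OF that(2)] b(2)[OF _ that(1)] Q(2) preceq_trans preceq_refl by metis
  moreover have "c lam = 1"
  proof -
    \<comment> \<open>A nonzero value would give \<open>lam \<preceq> \<mu>\<close>, although
      \<open>\<mu>\<close> lies strictly below \<open>lam\<close>; hence the diagonal entry receives
      no correction.\<close>
    have "b \<mu> lam = 0" if "\<mu> \<in> Q" for \<mu>
    proof (rule ccontr)
      assume "b \<mu> lam \<noteq> 0"
      then have "lam \<preceq> \<mu>" using b(2) that less.prems by blast
      moreover have "lam \<noteq> \<mu>" using that by (auto simp: Q_def)
      ultimately have "lookup lam 0 < lookup \<mu> 0"
        using preceq_first_part_less less.prems Q(1)[OF that] by blast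
      with Q(3)[OF that] show False by simp
    qed
    then show ?thesis by (simp add: c_def)
  qed
  moreover have "msym N lam = (\<Sum>\<kappa>\<in>?P. scale (c \<kappa>) (msym_mod N \<kappa>))"
  proof -
    have "?m = (\<Sum>\<mu>\<in>?P. scale (lookup ?m \<mu>) (msym N \<mu>))"
      using N less.prems by (intro sym_homogeneous_expansion msym_mod_in_sym_homogeneous)
    also have "\<dots> = msym N lam + (\<Sum>\<mu>\<in>?P - {lam}. scale (lookup ?m \<mu>) (msym N \<mu>))"
      using N less.prems
      by (simp add: sum.remove[OF finite_partitions] lookup_msym_mod_self)
    also have "(\<Sum>\<mu>\<in>?P - {lam}. scale (lookup ?m \<mu>) (msym N \<mu>)) =
        (\<Sum>\<mu>\<in>Q. scale (lookup ?m \<mu>) (msym N \<mu>))"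
      unfolding Q_def by (rule sum.mono_neutral_right) (auto simp: finite_partitions)
    also have "\<dots> = (\<Sum>\<mu>\<in>Q. \<Sum>\<kappa>\<in>?P. scale (lookup ?m \<mu> * b \<mu> \<kappa>) (msym_mod N \<kappa>))"
      by (intro sum.cong) (simp_all add: b(3) mpoly.scale_sum_right)
    also have "\<dots> = (\<Sum>\<kappa>\<in>?P. scale (\<Sum>\<mu>\<in>Q. lookup ?m \<mu> * b \<mu> \<kappa>) (msym_mod N \<kappa>))"
      by (subst sum.swap) (simp add: mpoly.scale_sum_left)
    finally have eq: "msym N lam =
        ?m - (\<Sum>\<kappa>\<in>?P. scale (\<Sum>\<mu>\<in>Q. lookup ?m \<mu> * b \<mu> \<kappa>) (msym_mod N \<kappa>))"
      by (simp add: algebra_simps)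
    have "?m = (\<Sum>\<kappa>\<in>?P. scale (if \<kappa> = lam then 1 else 0) (msym_mod N \<kappa>))"
      using less.prems
      by (simp add: if_distrib[of "\<lambda>c. scale c _"] finite_partitions cong: if_cong)
    then show ?thesis
      unfolding eq by (simp add: c_def mpoly.scale_left_diff_distrib sum_subtractf)
  qed
  ultimately show ?case by blast
qed

text \<open>Symmetric polynomials expand in the \<open>msym\<close>, and these in turn in the
  \<open>msym_mod\<close>; the other inclusion holds because \<open>sym_homogeneous N n\<close> is a
  subspace containing the generators.\<close>

lemma span_msym_mod:
  assumes "N \<ge> 1"
  shows "mpoly.span ((msym_mod N :: _ \<Rightarrow> 'a::field mpoly) ` partitions N n) = sym_homogeneous N n"
    (is "mpoly.span ?M = _")
proof
  show "mpoly.span ?M \<subseteq> sym_homogeneous N n"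
    using msym_mod_in_sym_homogeneous[OF assms] subspace_sym_homogeneous
    by (intro mpoly.span_minimal) auto
  show "sym_homogeneous N n \<subseteq> mpoly.span ?M"
  proof
    fix p :: "'a mpoly" assume p: "p \<in> sym_homogeneous N n"
    have "msym N lam \<in> mpoly.span ?M" if lam: "lam \<in> partitions N n" for lam
    proof -
      obtain b :: "_ \<Rightarrow> 'a" where b:
        "msym N lam = (\<Sum>\<mu>\<in>partitions N n. scale (b \<mu>) (msym_mod N \<mu>))"
        using msym_expansion[OF assms lam] by blast
      show ?thesis
        unfolding b by (intro mpoly.span_sum mpoly.span_scale mpoly.span_base imageI)
    qed
    then show "p \<in> mpoly.span ?M"
      by (subst sym_homogeneous_expansion[OF p]) (intro mpoly.span_sum mpoly.span_scale)
  qed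
qed

theorem proposition3:
  fixes N n :: nat
  assumes "N \<ge> 1"
  shows
    "inj_on (msym_mod N :: _ \<Rightarrow> 'a::field_char_0 mpoly) (partitions N n) \<and>
     mpoly.independent ((msym_mod N :: _ \<Rightarrow> 'a mpoly) ` partitions N n) \<and>
     mpoly.span ((msym_mod N :: _ \<Rightarrow> 'a mpoly) ` partitions N n) = sym_homogeneous N n \<and>
     (\<exists>B :: _ \<Rightarrow> _ \<Rightarrow> 'a. transition_matrix N n B) \<and>
     (\<forall>B :: _ \<Rightarrow> _ \<Rightarrow> 'a. transition_matrix N n B \<longrightarrow>
        (\<forall>\<mu>\<in>partitions N n. \<forall>lam\<in>partitions N n. B \<mu> lam \<noteq> 0 \<longrightarrow> \<mu> \<preceq> lam) \<and>
        (\<forall>lam\<in>partitions N n. B lam lam = 1) \<and>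
        (\<forall>\<mu>\<in>partitions N n. \<forall>lam\<in>partitions N n. B \<mu> lam \<in> \<int>))"
proof -
  let ?P = "partitions N n"
  have "\<forall>lam\<in>?P. \<exists>b :: _ \<Rightarrow> 'a. (\<forall>\<mu>. b \<mu> \<in> \<int>) \<and> (\<forall>\<mu>\<in>?P. b \<mu> \<noteq> 0 \<longrightarrow> \<mu> \<preceq> lam) \<and>
    b lam = 1 \<and> msym N lam = (\<Sum>\<mu>\<in>?P. scale (b \<mu>) (msym_mod N \<mu>))"
    using msym_expansion[OF assms] by blast
  from bchoice[OF this] obtain b :: "_ \<Rightarrow> _ \<Rightarrow> 'a" where b: "\<And>lam \<mu>. lam \<in> ?P \<Longrightarrow> b lam \<mu> \<in> \<int>"
    "\<And>lam \<mu>. lam \<in> ?P \<Longrightarrow> \<mu> \<in> ?P \<Longrightarrow> b lam \<mu> \<noteq> 0 \<Longrightarrow> \<mu> \<preceq> lam"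
    "\<And>lam. lam \<in> ?P \<Longrightarrow> b lam lam = 1"
    "\<And>lam. lam \<in> ?P \<Longrightarrow> msym N lam = (\<Sum>\<mu>\<in>?P. scale (b lam \<mu>) (msym_mod N \<mu>))"
    by blast
  have "transition_matrix N n (\<lambda>\<mu> lam. b lam \<mu>)"
    using b(4) by (simp add: transition_matrix_def)
  \<comment> \<open>Uniqueness of coefficients makes every transition matrix agree with
    \<open>b\<close> on partitions, so the properties of the constructed matrix hold for all of
    them.\<close>
  moreover have B: "B \<mu> lam = b lam \<mu>"
    if "transition_matrix N n B" "\<mu> \<in> ?P" "lam \<in> ?P" for B :: "_ \<Rightarrow> _ \<Rightarrow> 'a" and \<mu> lam
  proof (rule msym_mod_coeffs_unique[OF assms _ that(2)])
    show "(\<Sum>\<mu>\<in>?P. scale (B \<mu> lam) (msym_mod N \<mu>)) = (\<Sum>\<mu>\<in>?P. scale (b lam \<mu>) (msym_mod N \<mu>))"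
      using that(1,3) b(4)[OF that(3)] by (simp add: transition_matrix_def)
  qed
  ultimately show ?thesis
    using inj_on_msym_mod[OF assms] independent_msym_mod[OF assms] span_msym_mod[OF assms] b(1-3)
    by (intro conjI allI impI ballI) (auto simp: B)
qed

end
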